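(* Let $(\xi_i,\mathcal F_i)_{i\ge1}$ be a supermartingale difference sequence, i.e. $\mathbb E[\xi_i\mid\mathcal F_{i-1}]\le0$ for all $i$, and put $S_k=\sum_{i=1}^k\xi_i$ and $V_k=\sum_{i=1}^k\mathrm{Var}[\xi_i\mid\mathcal F_{i-1}]$. Assume $\xi_i\le B$ for all $i\ge1$, where $B>0$ is a constant. Put $\widetilde V_k=V_k\vee B^2$ and $\kappa=\pi^2/6$. Then for all $\delta\in(0,1/(1+\kappa))$, with probability at least $1-(1+\kappa)\delta$, $$\forall k\ge1:\quad S_k\le2\sqrt{\widetilde V_k\,\varepsilon(\delta,k)}+\frac12B\,\varepsilon(\delta,k),$$ where $\varepsilon(\delta,k)=\log\delta^{-1}+2\log\bigl(1+\log_2(\widetilde V_k/B^2)\bigr)$.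
   Context: $(\mathcal F_i)_{i\ge0}$ is a filtration, each $\xi_i$ is $\mathcal F_i$-measurable and square-integrable, and $\mathrm{Var}[\xi_i\mid\mathcal F_{i-1}]$ is the conditional variance of $\xi_i$ given $\mathcal F_{i-1}$. *)

theory Defs
  imports "HOL-Probability.Probability"
begin

definition cond_variance :: "'a measure \<Rightarrow> 'a measure \<Rightarrow> ('a \<Rightarrow> real) \<Rightarrow> 'a \<Rightarrow> real" where
  "cond_variance M G X =
     real_cond_exp M G (\<lambda>\<omega>. (X \<omega> - real_cond_exp M G X \<omega>)\<^sup>2)"

definition partial_sum :: "(nat \<Rightarrow> 'a \<Rightarrow> real) \<Rightarrow> nat \<Rightarrow> 'a \<Rightarrow> real" where
  "partial_sum \<xi> k \<omega> = (\<Sum>i=1..k. \<xi> i \<omega>)"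

definition cond_variance_sum ::
  "'a measure \<Rightarrow> (nat \<Rightarrow> 'a measure) \<Rightarrow> (nat \<Rightarrow> 'a \<Rightarrow> real) \<Rightarrow> nat \<Rightarrow> 'a \<Rightarrow> real" where
  "cond_variance_sum M F \<xi> k \<omega> = (\<Sum>i=1..k. cond_variance M (F (i - 1)) (\<xi> i) \<omega>)"

(* The index 0 only serves the filtration: nothing is required of \<xi> 0. *)
definition supermartingale_difference_seq ::
  "'a measure \<Rightarrow> (nat \<Rightarrow> 'a measure) \<Rightarrow> (nat \<Rightarrow> 'a \<Rightarrow> real) \<Rightarrow> bool" where
  "supermartingale_difference_seq M F \<xi> \<longleftrightarrow>
     filtration (space M) F \<and> (\<forall>i. subalgebra M (F i)) \<and>
     (\<forall>i\<ge>1. \<xi> i \<in> borel_measurable (F i) \<and>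
            integrable M (\<lambda>\<omega>. (\<xi> i \<omega>)\<^sup>2) \<and>
            (AE \<omega> in M. real_cond_exp M (F (i - 1)) (\<xi> i) \<omega> \<le> 0))"

end

theory Submission
  imports Defs
begin

text \<open>If \<open>X \<le> B\<close> has conditional mean at most \<open>0\<close> and conditional variance \<open>s\<close>, then
\<open>E[exp (l X) | F] \<le> exp (g s)\<close> with \<open>g = l\<^sup>2 / (2 - l B)\<close> for \<open>0 < l < 2 / B\<close>. Hence
\<open>exp (l S\<^sub>n - g V\<^sub>n)\<close> is a nonnegative supermartingale, and the maximal inequality with the optimal \<open>l\<close>
shows that \<open>V\<^sub>n \<le> v\<close> and \<open>S\<^sub>n \<ge> sqrt (2 v e) + B e / 2\<close> hold for some \<open>n\<close> with probability at most
\<open>exp (-e)\<close>. Peeling over the slices \<open>2\<^sup>j B\<^sup>2 \<le> V'\<^sub>n \<le> 2\<^bsup>j+1\<^esup> B\<^sup>2\<close> with \<open>v = 2\<^bsup>j+1\<^esup> B\<^sup>2\<close> and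
\<open>e = ln (1/\<delta>) + 2 ln (1 + j)\<close> gives the total failure probability \<open>\<delta> \<Sum>\<^sub>j 1 / (1 + j)\<^sup>2 = \<kappa> \<delta>\<close>.\<close>

section \<open>Elementary inequalities for the exponential function\<close>

text \<open>The difference of the two sides vanishes at 0 and has derivative
  \<open>1 - (1 - y) * exp y\<close>, nonnegative because \<open>1 - y <= exp (- y)\<close>. It is
  used twice: for the monotonicity of the Taylor remainder quotient and for the rational bound in
  \<open>exp_remainder_le\<close>.\<close>

lemma two_minus_mult_exp_le:
  fixes x :: real
  assumes "0 \<le> x"
  shows "(2 - x) * exp x \<le> 2 + x"
proof -
  define f where "f = (\<lambda>x::real. 2 + x - (2 - x) * exp x)"
  have "f 0 \<le> f x"
  proof (rule DERIV_nonneg_imp_nondecreasing[OF assms])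
    fix y :: real assume "0 \<le> y" "y \<le> x"
    have "(1 - y) * exp y \<le> exp (- y) * exp y"
      using exp_ge_add_one_self[of "-y"] by (intro mult_right_mono) auto
    then have "0 \<le> 1 - (1 - y) * exp y"
      by (simp add: exp_minus)
    moreover have "(f has_real_derivative 1 - (1 - y) * exp y) (at y)"
      unfolding f_def by (auto intro!: derivative_eq_intros simp: algebra_simps)
    ultimately show "\<exists>z. (f has_real_derivative z) (at y) \<and> 0 \<le> z" by blast
  qed
  then show ?thesis by (simp add: f_def)
qed

text \<open>Up to a positive factor, the derivative of the quotient at \<open>z\<close> is
  \<open>2 + z - (2 - z) * exp z\<close>.\<close>

lemma exp_remainder_quotient_mono:
  fixes x y :: real
  assumes "0 < x" "x \<le> y"
  shows "(exp x - 1 - x) / x\<^sup>2 \<le> (exp y - 1 - y) / y\<^sup>2"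
proof (rule DERIV_nonneg_imp_nondecreasing[OF assms(2)])
  fix z assume z: "x \<le> z" "z \<le> y"
  then have z0: "0 < z" using assms by simp
  let ?D = "((exp z - 1) * z\<^sup>2 - (exp z - 1 - z) * (2 * z)) / (z\<^sup>2 * z\<^sup>2)"
  have "((\<lambda>x. (exp x - 1 - x) / x\<^sup>2) has_real_derivative ?D) (at z)"
    using z0 by (auto intro!: derivative_eq_intros)
  moreover have "(exp z - 1) * z\<^sup>2 - (exp z - 1 - z) * (2 * z) = z * (2 + z - (2 - z) * exp z)"
    by (simp add: algebra_simps power2_eq_square)
  then have "0 \<le> ?D"
    using two_minus_mult_exp_le[of z] z0 by simp
  ultimately show "\<exists>D. ((\<lambda>x. (exp x - 1 - x) / x\<^sup>2) has_real_derivative D) (at z) \<and> 0 \<le> D"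
    by blast
qed

text \<open>Bound the reciprocal \<open>exp (- x)\<close> from below by its Taylor polynomial; the
  product of the two quadratics is \<open>1 + x^4 / 4\<close>, hence at least 1.\<close>

lemma exp_le_quadratic_nonpos:
  fixes x :: real
  assumes "x \<le> 0"
  shows "exp x \<le> 1 + x + x\<^sup>2 / 2"
proof -
  have pos: "0 < 1 - x + x\<^sup>2 / 2" using assms by (simp add: add_pos_nonneg)
  have "1 - x + x\<^sup>2 / 2 \<le> exp (- x)"
    using exp_lower_Taylor_quadratic[of "-x"] assms by simp
  then have "exp x * (1 - x + x\<^sup>2 / 2) \<le> exp x * exp (- x)"
    by (intro mult_left_mono) auto
  also have "\<dots> = 1" by (simp add: exp_minus)
  also have "\<dots> \<le> 1 + (x\<^sup>2)\<^sup>2 / 4" by simp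
  also have "\<dots> = (1 + x + x\<^sup>2 / 2) * (1 - x + x\<^sup>2 / 2)"
    by (simp add: algebra_simps power2_eq_square)
  finally show ?thesis using pos by simp
qed

text \<open>For positive \<open>x\<close> this is monotonicity of the remainder quotient. For
  \<open>x <= 0\<close> the coefficient 1/2 suffices, and the quotient at \<open>y > 0\<close> is at
  least 1/2.\<close>

lemma exp_le_quadratic:
  fixes x y :: real
  assumes "x \<le> y" "0 < y"
  shows "exp x \<le> 1 + x + (exp y - 1 - y) / y\<^sup>2 * x\<^sup>2"
proof (cases "x \<le> 0")
  case True
  have "1 / 2 \<le> (exp y - 1 - y) / y\<^sup>2"
    using exp_lower_Taylor_quadratic[of y] assms by (simp add: field_simps)
  then have "1 / 2 * x\<^sup>2 \<le> (exp y - 1 - y) / y\<^sup>2 * x\<^sup>2"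
    by (intro mult_right_mono) auto
  then show ?thesis using exp_le_quadratic_nonpos[OF True] by linarith
next
  case False
  then have "(exp x - 1 - x) / x\<^sup>2 * x\<^sup>2 \<le> (exp y - 1 - y) / y\<^sup>2 * x\<^sup>2"
    using assms by (intro mult_right_mono exp_remainder_quotient_mono) auto
  then show ?thesis using False by simp
qed

section \<open>The extremal two-point law and its exponential moment\<close>

text \<open>Among the laws on \<open>(-\<infinity>, B]\<close> with mean \<open>m\<close> and variance \<open>s\<close>, the exponential moment is largest
for the one carried by \<open>{-a, B}\<close>; the left-hand side is its exponential moment. Since \<open>m \<le> 0\<close>, raising
the lower atom to \<open>-r\<close>, where the mean vanishes, only increases it, and reduces the claim to
Bennett's bound for centred variables.\<close>

lemma two_point_exp_moment_le:
  fixes B l m s :: real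
  defines "b \<equiv> B - m"
  defines "a \<equiv> s / b - m"
  assumes "0 < B" "0 < l" "m \<le> 0" "0 \<le> s"
  shows "exp (- (l * a)) * (1 + l * (a + m)
           + (exp (l * (B + a)) - 1 - l * (B + a)) / (B + a)\<^sup>2 * (s + (a + m)\<^sup>2))
         \<le> 1 + (exp (l * B) - 1 - l * B) / B\<^sup>2 * s"
proof -
  \<comment> \<open>\<open>p\<close> and \<open>q\<close> are the masses at \<open>B\<close> and
    \<open>-a\<close> that give mean \<open>m\<close> and variance \<open>s\<close>. With the masses
    kept, \<open>-r\<close> is the lower atom that makes the mean zero:
    \<open>q * r = p * B\<close>.\<close>
  define p q r \<phi> where "p = s / (s + b\<^sup>2)" and "q = b\<^sup>2 / (s + b\<^sup>2)" and "r = B * s / b\<^sup>2"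
    and "\<phi> = exp (l * B) - 1 - l * B"
  have b: "0 < b" "B \<le> b" using assms by auto
  have sb: "0 < s + b\<^sup>2" using b assms by (simp add: add_nonneg_pos)
  have Ba: "B + a = (s + b\<^sup>2) / b" using b by (simp add: a_def b_def field_simps power2_eq_square)
  have am: "a + m = s / b" by (simp add: a_def)
  have sq: "s + (a + m)\<^sup>2 = s * (s + b\<^sup>2) / b\<^sup>2"
    unfolding am using b by (simp add: field_simps power2_eq_square)
  have pq: "p + q = 1" "0 \<le> p" "0 < q" "q * r = p * B" "p / q = s / b\<^sup>2"
  proof -
    define w where "w = s + b\<^sup>2"
    have w: "0 < w" "p = s / w" "q = b\<^sup>2 / w" using sb by (simp_all add: w_def p_def q_def)
    have "p + q = w / w" unfolding w(2,3) by (simp add: w_def flip: add_divide_distrib)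
    then show "p + q = 1" using w by simp
    show "0 \<le> p" "0 < q" "q * r = p * B" "p / q = s / b\<^sup>2"
      using w b \<open>0 \<le> s\<close> by (auto simp: r_def)
  qed
  have ratio: "(s + (a + m)\<^sup>2) / (B + a)\<^sup>2 = p" and p_Ba: "p * (B + a) = a + m"
  proof -
    define w where "w = s + b\<^sup>2"
    have w: "0 < w" "p = s / w" "s + (a + m)\<^sup>2 = s * w / b\<^sup>2" "B + a = w / b"
      using sb sq Ba by (simp_all add: w_def p_def)
    show "(s + (a + m)\<^sup>2) / (B + a)\<^sup>2 = p"
      unfolding w(2-4) using w(1) b by (simp add: power2_eq_square)
    show "p * (B + a) = a + m"
      unfolding w(2,4) am using w(1) by simp
  qed
  have "(exp (l * (B + a)) - 1 - l * (B + a)) / (B + a)\<^sup>2 * (s + (a + m)\<^sup>2)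
        = (exp (l * (B + a)) - 1 - l * (B + a)) * p"
    unfolding ratio[symmetric] by simp
  also have "\<dots> = p * (exp (l * (B + a)) - 1) - l * (p * (B + a))"
    by (simp add: algebra_simps)
  also have "\<dots> = p * (exp (l * (B + a)) - 1) - l * (a + m)"
    unfolding p_Ba ..
  finally have eq: "(exp (l * (B + a)) - 1 - l * (B + a)) / (B + a)\<^sup>2 * (s + (a + m)\<^sup>2)
        = p * (exp (l * (B + a)) - 1) - l * (a + m)" .
  have "exp (- (l * a)) * (1 + l * (a + m)
           + (exp (l * (B + a)) - 1 - l * (B + a)) / (B + a)\<^sup>2 * (s + (a + m)\<^sup>2))
        = exp (- (l * a)) * ((1 - p) + p * exp (l * (B + a)))"
    unfolding eq by (simp add: algebra_simps)
  also have "\<dots> = q * exp (- (l * a)) + p * exp (l * B)"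
  proof -
    have "q = 1 - p" using pq(1) by simp
    show ?thesis unfolding \<open>q = 1 - p\<close> by (simp add: algebra_simps flip: exp_add)
  qed
  \<comment> \<open>Both atoms of the recentred law get the quadratic bound with
    \<open>y = l * B\<close>, an equality at \<open>B\<close>. The linear terms then cancel, and the
    quadratic ones add up to the coefficient \<open>p / q = s / b^2\<close>, at most
    \<open>s / B^2\<close> since \<open>b >= B\<close>.\<close>
  also have "\<dots> \<le> q * (1 - l * r + \<phi> * (r / B)\<^sup>2) + p * (1 + l * B + \<phi>)"
  proof -
    have "B * s \<le> b * s" using b assms by (intro mult_right_mono) auto
    then have "r \<le> s / b" unfolding r_def using b by (simp add: field_simps power2_eq_square)
    also have "\<dots> \<le> a" using assms by (simp add: a_def)
    finally have "r \<le> a" .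
    then have "exp (- (l * a)) \<le> exp (- (l * r))" using assms by (simp add: mult_left_mono)
    also have "\<dots> \<le> 1 - l * r + \<phi> * (r / B)\<^sup>2"
    proof -
      have "0 \<le> r" using assms b by (simp add: r_def)
      then have "- (l * r) \<le> l * B" using assms
        by (smt (verit) mult_nonneg_nonneg)
      then show ?thesis
        using exp_le_quadratic[of "- (l * r)" "l * B"] assms
        by (simp add: \<phi>_def power_mult_distrib power_divide)
    qed
    finally show ?thesis using pq
      by (intro add_mono mult_left_mono) (auto simp: \<phi>_def)
  qed
  also have "\<dots> = 1 + \<phi> * (p / q)"
  proof -
    have rB: "r / B = p / q" using pq(3,4) \<open>0 < B\<close> by (simp add: field_simps)
    have 1: "q * (r / B)\<^sup>2 = p * (p / q)" unfolding rB using pq(3) by (simp add: power2_eq_square)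
    have "p + p * (p / q) = (p + q) * (p / q)" using pq(3) by (simp add: field_simps)
    then have 2: "p + p * (p / q) = p / q" using pq(1) by simp
    have "q * (1 - l * r + \<phi> * (r / B)\<^sup>2) + p * (1 + l * B + \<phi>)
      = (p + q) + l * (p * B - q * r) + \<phi> * (p + q * (r / B)\<^sup>2)"
      by (simp add: algebra_simps)
    then show ?thesis using 1 2 pq(1,4) by simp
  qed
  also have "\<dots> \<le> 1 + \<phi> * (s / B\<^sup>2)"
  proof -
    have "0 \<le> \<phi>" using exp_ge_add_one_self[of "l * B"] unfolding \<phi>_def by linarith
    moreover have "s / b\<^sup>2 \<le> s / B\<^sup>2"
      using b assms by (intro divide_left_mono power_mono) auto
    ultimately show ?thesis unfolding pq(5) by (intro add_left_mono mult_left_mono)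
  qed
  finally show ?thesis by (simp add: \<phi>_def)
qed

text \<open>With \<open>y = l * B\<close>, subtract \<open>(1 + y) * (2 - y)\<close> from both sides
  of \<open>(2 - y) * exp y <= 2 + y\<close>. The rational rate allows \<open>l\<close> to be
  optimised in closed form later on.\<close>

lemma exp_remainder_le:
  fixes l B :: real
  assumes "0 < B" "0 \<le> l" "l * B < 2"
  shows "(exp (l * B) - 1 - l * B) / B\<^sup>2 \<le> l\<^sup>2 / (2 - l * B)"
proof -
  have "(exp (l * B) - 1 - l * B) * (2 - l * B) \<le> l\<^sup>2 * B\<^sup>2"
    using two_minus_mult_exp_le[of "l * B"] assms by (simp add: algebra_simps power2_eq_square)
  then show ?thesis using assms by (simp add: field_simps)
qed

section \<open>Conditional variance and conditional exponential moments\<close>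

lemma (in finite_measure) integrable_exp_bounded_above:
  fixes X :: "'a \<Rightarrow> real"
  assumes [measurable]: "X \<in> borel_measurable M" and "AE x in M. X x \<le> C"
  shows "integrable M (\<lambda>x. exp (X x))"
  by (rule integrable_const_bound[where B = "exp C"]) (use assms(2) in auto)

context finite_measure_subalgebra
begin

text \<open>Expand the square and pull the \<open>F\<close>-measurable mean \<open>m\<close> out of
  the mixed term. The integrability this requires comes from conditional Jensen for
  \<open>m^2\<close> and from domination by \<open>m^2 + X^2\<close> for
  \<open>m * X\<close>.\<close>

lemma real_cond_exp_power2:
  assumes [measurable]: "X \<in> borel_measurable M" and X2: "integrable M (\<lambda>x. (X x)\<^sup>2)"
  shows "AE x in M. real_cond_exp M F (\<lambda>x. (X x)\<^sup>2) x
           = cond_variance M F X x + (real_cond_exp M F X x)\<^sup>2"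
proof -
  define m where "m = real_cond_exp M F X"
  have m[measurable]: "m \<in> borel_measurable F" "m \<in> borel_measurable M"
    unfolding m_def by auto
  have X1: "integrable M X" by (rule square_integrable_imp_integrable[OF _ X2]) simp
  have m2: "integrable M (\<lambda>x. (m x)\<^sup>2)"
    unfolding m_def
    by (rule integrable_convex_cond_exp[where I = UNIV and q = "\<lambda>x. x\<^sup>2"])
      (use X1 X2 in \<open>auto intro!: convex_power2\<close>)
  have mX: "integrable M (\<lambda>x. m x * X x)"
  proof (rule Bochner_Integration.integrable_bound)
    show "integrable M (\<lambda>x. (m x)\<^sup>2 + (X x)\<^sup>2)" using m2 X2 by simp
    have "\<bar>a * b\<bar> \<le> a\<^sup>2 + b\<^sup>2" for a b :: real
      using sum_squares_bound[of "\<bar>a\<bar>" "\<bar>b\<bar>"] abs_ge_zero[of "a * b"]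
      unfolding abs_mult power2_abs by linarith
    then show "AE x in M. norm (m x * X x) \<le> norm ((m x)\<^sup>2 + (X x)\<^sup>2)" by simp
  qed simp
  have var: "cond_variance M F X
      = real_cond_exp M F (\<lambda>x. (X x)\<^sup>2 - 2 * (m x * X x) + (m x)\<^sup>2)"
    unfolding cond_variance_def m_def by (simp add: power2_diff algebra_simps)
  have "AE x in M. real_cond_exp M F (\<lambda>x. (X x)\<^sup>2 - 2 * (m x * X x)) x
      = real_cond_exp M F (\<lambda>x. (X x)\<^sup>2) x - real_cond_exp M F (\<lambda>x. 2 * (m x * X x)) x"
    using X2 mX by simp
  moreover have "AE x in M. real_cond_exp M F (\<lambda>x. (X x)\<^sup>2 - 2 * (m x * X x) + (m x)\<^sup>2) x
      = real_cond_exp M F (\<lambda>x. (X x)\<^sup>2 - 2 * (m x * X x)) x + real_cond_exp M F (\<lambda>x. (m x)\<^sup>2) x"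
    using X2 mX m2 by (intro real_cond_exp_add) auto
  moreover have "AE x in M. real_cond_exp M F (\<lambda>x. 2 * (m x * X x)) x
      = 2 * real_cond_exp M F (\<lambda>x. m x * X x) x"
    using mX by simp
  moreover have "AE x in M. real_cond_exp M F (\<lambda>x. m x * X x) x = m x * m x"
    using real_cond_exp_mult[OF m(1) _ mX] by (simp add: m_def)
  moreover have "AE x in M. real_cond_exp M F (\<lambda>x. (m x)\<^sup>2) x = (m x)\<^sup>2"
    using m2 by (intro real_cond_exp_F_meas) auto
  ultimately show ?thesis
    unfolding m_def[symmetric] var by eventually_elim (simp add: power2_eq_square)
qed

lemma cond_variance_nonneg:
  assumes [measurable]: "X \<in> borel_measurable M"
  shows "AE x in M. 0 \<le> cond_variance M F X x"
  unfolding cond_variance_def by (rule real_cond_exp_pos) auto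

text \<open>\<open>exp (l * x)\<close> lies below a parabola on \<open>x <= B\<close> that is
  tangent to it at \<open>-a\<close> and meets it at \<open>B\<close>; conditioning the parabola
  leaves only the first two conditional moments. Equality at both points makes the bound sharp for
  laws on \<open>{-a, B}\<close>.\<close>

lemma real_cond_exp_exp_le_shifted:
  assumes [measurable]: "X \<in> borel_measurable M" and X2: "integrable M (\<lambda>x. (X x)\<^sup>2)"
    and XB: "AE x in M. X x \<le> B" and "0 < l" "0 < B + a"
  shows "AE x in M. real_cond_exp M F (\<lambda>x. exp (l * X x)) x \<le>
    exp (- (l * a)) * (1 + l * (a + real_cond_exp M F X x)
      + (exp (l * (B + a)) - 1 - l * (B + a)) / (B + a)\<^sup>2
        * (cond_variance M F X x + (a + real_cond_exp M F X x)\<^sup>2))"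
proof -
  define D where "D = (exp (l * (B + a)) - 1 - l * (B + a)) / (B + a)\<^sup>2"
  define c0 c1 c2 where "c0 = exp (- (l * a)) * (1 + l * a + D * a\<^sup>2)"
    and "c1 = exp (- (l * a)) * (l + 2 * D * a)" and "c2 = exp (- (l * a)) * D"
  have X1: "integrable M X" by (rule square_integrable_imp_integrable[OF _ X2]) simp
  have bound: "exp (l * x) \<le> c0 + c1 * x + c2 * x\<^sup>2" if "x \<le> B" for x
  proof -
    have "exp (l * (x + a)) \<le> 1 + l * (x + a)
        + (exp (l * (B + a)) - 1 - l * (B + a)) / (l * (B + a))\<^sup>2 * (l * (x + a))\<^sup>2"
      using that assms by (intro exp_le_quadratic) auto
    also have "\<dots> = 1 + l * (x + a) + D * (x + a)\<^sup>2"
      using assms by (simp add: D_def power_mult_distrib)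
    finally have "exp (- (l * a)) * exp (l * (x + a)) \<le> exp (- (l * a)) * (1 + l * (x + a) + D * (x + a)\<^sup>2)"
      by simp
    also have "\<dots> = c0 + c1 * x + c2 * x\<^sup>2"
      by (simp add: c0_def c1_def c2_def power2_sum algebra_simps)
    finally show ?thesis by (simp add: algebra_simps flip: exp_add)
  qed
  have "AE x in M. l * X x \<le> l * B" using XB \<open>0 < l\<close> by simp
  then have "AE x in M. real_cond_exp M F (\<lambda>x. exp (l * X x)) x
      \<le> real_cond_exp M F (\<lambda>x. c0 + c1 * X x + c2 * (X x)\<^sup>2) x"
    using X1 X2 XB bound by (intro real_cond_exp_mono integrable_exp_bounded_above) auto
  moreover have "AE x in M. real_cond_exp M F (\<lambda>x. c0 + c1 * X x + c2 * (X x)\<^sup>2) x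
      = real_cond_exp M F (\<lambda>x. c0 + c1 * X x) x + real_cond_exp M F (\<lambda>x. c2 * (X x)\<^sup>2) x"
    using X1 X2 by (intro real_cond_exp_add) auto
  moreover have "AE x in M. real_cond_exp M F (\<lambda>x. c0 + c1 * X x) x
      = real_cond_exp M F (\<lambda>x. c0) x + real_cond_exp M F (\<lambda>x. c1 * X x) x"
    using X1 by (intro real_cond_exp_add) auto
  moreover have "AE x in M. real_cond_exp M F (\<lambda>x. c0) x = c0"
    by (intro real_cond_exp_F_meas) auto
  moreover have "AE x in M. real_cond_exp M F (\<lambda>x. c1 * X x) x = c1 * real_cond_exp M F X x"
    using X1 by simp
  moreover have "AE x in M. real_cond_exp M F (\<lambda>x. c2 * (X x)\<^sup>2) x
      = c2 * real_cond_exp M F (\<lambda>x. (X x)\<^sup>2) x"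
    using X2 by simp
  ultimately show ?thesis
    using real_cond_exp_power2[OF assms(1) X2] unfolding D_def[symmetric]
    by eventually_elim (simp add: c0_def c1_def c2_def power2_sum algebra_simps)
qed

text \<open>The shift minimising the previous bound is random. Using only countably many constant shifts
and continuity in the shift avoids conditioning on products with unbounded random coefficients.\<close>

lemma real_cond_exp_exp_le:
  assumes X: "X \<in> borel_measurable M" "integrable M (\<lambda>x. (X x)\<^sup>2)"
    and XB: "AE x in M. X x \<le> B" and X0: "AE x in M. real_cond_exp M F X x \<le> 0"
    and B: "0 < B" and l: "0 < l" "l * B < 2"
  shows "AE x in M. real_cond_exp M F (\<lambda>x. exp (l * X x)) x
           \<le> exp (l\<^sup>2 / (2 - l * B) * cond_variance M F X x)"
proof -
  define E m s where "E = real_cond_exp M F (\<lambda>x. exp (l * X x))"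
    and "m = real_cond_exp M F X" and "s = cond_variance M F X"
  define R where "R = (\<lambda>x a. exp (- (l * a)) * (1 + l * (a + m x)
      + (exp (l * (B + a)) - 1 - l * (B + a)) / (B + a)\<^sup>2 * (s x + (a + m x)\<^sup>2)))"
  \<comment> \<open>The closure must contain every \<open>a >= 0\<close> and stay away from the pole
    of the bound at \<open>-B\<close>; any lower end strictly between \<open>-B\<close> and 0 would
    serve.\<close>
  define Q where "Q = {- (B / 2)<..} \<inter> (\<rat> :: real set)"
  have Q: "closure Q = {- (B / 2)..}"
    unfolding Q_def using closure_open_Int_superset[of "{- (B / 2)<..}" "\<rat>"]
    by (simp add: Rats_closure_real)
  have "countable Q" unfolding Q_def by (simp add: countable_rat)
  moreover have "AE x in M. E x \<le> R x a" if "a \<in> Q" for a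
    unfolding E_def m_def s_def R_def
    by (rule real_cond_exp_exp_le_shifted[OF X XB l(1)]) (use that B in \<open>auto simp: Q_def\<close>)
  ultimately have "AE x in M. \<forall>a\<in>Q. E x \<le> R x a"
    by (intro AE_ball_countable[THEN iffD2] ballI)
  moreover have "AE x in M. 0 \<le> s x"
    unfolding s_def by (rule cond_variance_nonneg[OF X(1)])
  moreover have "AE x in M. m x \<le> 0" using X0 by (simp add: m_def)
  ultimately have "AE x in M. E x \<le> exp (l\<^sup>2 / (2 - l * B) * s x)"
  proof eventually_elim
    case (elim x)
    \<comment> \<open>\<open>-a\<close> is the lower atom of the two-point law on
      \<open>{-a, B}\<close> with mean \<open>m x\<close> and variance \<open>s x\<close>.\<close>
    define a where "a = s x / (B - m x) - m x"
    have "0 \<le> s x / (B - m x)" using elim B by simp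
    then have a: "0 \<le> a" unfolding a_def using elim by linarith
    have "continuous_on (closure Q) (R x)"
      unfolding Q R_def using B by (intro continuous_intros) auto
    moreover have "a \<in> closure Q" using a B by (simp add: Q)
    ultimately have "E x \<le> R x a"
      by (rule continuous_ge_on_closure) (use elim in auto)
    also have "\<dots> \<le> 1 + (exp (l * B) - 1 - l * B) / B\<^sup>2 * s x"
      unfolding R_def a_def using B l elim by (intro two_point_exp_moment_le) auto
    also have "\<dots> \<le> 1 + l\<^sup>2 / (2 - l * B) * s x"
      using B l elim by (intro add_left_mono mult_right_mono exp_remainder_le) auto
    also have "\<dots> \<le> exp (l\<^sup>2 / (2 - l * B) * s x)"
      by (rule exp_ge_add_one_self)
    finally show ?case .
  qed
  then show ?thesis by (simp add: E_def s_def)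
qed

end

section \<open>Maximal inequality for nonnegative supermartingales\<close>

text \<open>Ville's inequality; the induction controls the process on the paths that have not yet crossed
the level.\<close>

lemma (in finite_measure) supermartingale_maximal_ineq:
  fixes Z :: "nat \<Rightarrow> 'a \<Rightarrow> real"
  assumes F: "filtration (space M) F" "\<And>n. subalgebra M (F n)"
    and Z: "\<And>n. Z n \<in> borel_measurable (F n)" "\<And>n. integrable M (Z n)" "\<And>n x. 0 \<le> Z n x"
    and super: "\<And>n A. A \<in> sets (F n) \<Longrightarrow>
      (\<integral>x. indicator A x * Z (Suc n) x \<partial>M) \<le> (\<integral>x. indicator A x * Z n x \<partial>M)"
    and c: "0 < c"
  shows "c * measure M {x \<in> space M. \<exists>n. c \<le> Z n x} \<le> (\<integral>x. Z 0 x \<partial>M)"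
proof -
  interpret filtration "space M" F by (fact F)
  define D where "D n = {x \<in> space M. \<forall>k\<le>n. Z k x < c}" for n
  have D: "D n \<in> sets (F n)" for n
  proof -
    have "{x \<in> space (F n). Z k x < c} \<in> sets (F n)" if "k \<in> {..n}" for k
    proof -
      have [measurable]: "Z k \<in> borel_measurable (F n)"
        using Z(1)[of k] sets_F_mono[of k n] that borel_measurable_subalgebra[of "F k" "F n"]
        by (simp add: space_F)
      show ?thesis by measurable
    qed
    then have "{x \<in> space (F n). \<forall>k\<in>{..n}. Z k x < c} \<in> sets (F n)"
      by (intro sets.sets_Collect_finite_All) auto
    moreover have "D n = {x \<in> space (F n). \<forall>k\<in>{..n}. Z k x < c}"
      unfolding D_def space_F by auto
    ultimately show ?thesis by (simp only:)
  qed
  have DM[measurable]: "D n \<in> sets M" for n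
    using D[of n] F(2)[of n] unfolding subalgebra_def by blast
  have Zi: "integrable M (\<lambda>x. indicator (D k) x * Z n x)" for k n
    using integrable_mult_indicator[OF DM Z(2)] by simp
  have Zi': "integrable M (\<lambda>x. indicator (D k) x * Z n x + c * indicator (space M - D k) x)" for k n
    by (intro Bochner_Integration.integrable_add Zi integrable_mult_right integrable_real_indicator)
      (auto simp: less_top[symmetric])
  have Z_integral: "(\<integral>x. indicator (D k) x * Z n x + c * indicator (space M - D k) x \<partial>M)
      = (\<integral>x. indicator (D k) x * Z n x \<partial>M) + c * measure M (space M - D k)" for k n
  proof -
    have "integrable M (\<lambda>x. c * indicator (space M - D k) x)"
      by (intro integrable_mult_right integrable_real_indicator) (auto simp: less_top[symmetric])
    from Bochner_Integration.integral_add[OF Zi this] show ?thesis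
      by (simp add: Int_absorb1)
  qed
  \<comment> \<open>Paths that have crossed by time \<open>n\<close> are frozen at the value
    \<open>c\<close>; the others carry \<open>Z n\<close>.\<close>
  have step: "(\<integral>x. indicator (D n) x * Z n x \<partial>M) + c * measure M (space M - D n)
      \<le> (\<integral>x. Z 0 x \<partial>M)" for n
  proof (induction n)
    case 0
    have "(\<integral>x. indicator (D 0) x * Z 0 x + c * indicator (space M - D 0) x \<partial>M) \<le> (\<integral>x. Z 0 x \<partial>M)"
      by (intro integral_mono Zi' Z) (auto simp: D_def indicator_def Z)
    then show ?case by (simp only: Z_integral)
  next
    case (Suc n)
    \<comment> \<open>A path crossing exactly at time \<open>Suc n\<close> has
      \<open>Z (Suc n) >= c\<close>, so freezing it only lowers the integrand.\<close>
    have "(\<integral>x. indicator (D (Suc n)) x * Z (Suc n) x + c * indicator (space M - D (Suc n)) x \<partial>M)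
      \<le> (\<integral>x. indicator (D n) x * Z (Suc n) x + c * indicator (space M - D n) x \<partial>M)"
      by (intro integral_mono Zi') (auto simp: D_def indicator_def le_Suc_eq Z)
    then have "(\<integral>x. indicator (D (Suc n)) x * Z (Suc n) x \<partial>M) + c * measure M (space M - D (Suc n))
      \<le> (\<integral>x. indicator (D n) x * Z (Suc n) x \<partial>M) + c * measure M (space M - D n)"
      by (simp only: Z_integral)
    also have "\<dots> \<le> (\<integral>x. indicator (D n) x * Z n x \<partial>M) + c * measure M (space M - D n)"
      using super[OF D] by simp
    finally show ?case using Suc by simp
  qed
  have "D n \<subseteq> D k" if "k \<le> n" for k n
    unfolding D_def using le_trans[OF _ that] by blast
  then have "incseq (\<lambda>n. space M - D n)"
    unfolding incseq_def by blast
  moreover have "range (\<lambda>n. space M - D n) \<subseteq> sets M"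
    using DM by blast
  ultimately have "(\<lambda>n. measure M (space M - D n)) \<longlonglongrightarrow> measure M (\<Union>n. space M - D n)"
    by (intro finite_Lim_measure_incseq)
  then have "(\<lambda>n. c * measure M (space M - D n)) \<longlonglongrightarrow> c * measure M (\<Union>n. space M - D n)"
    by (rule tendsto_mult_left)
  moreover have "c * measure M (space M - D n) \<le> (\<integral>x. Z 0 x \<partial>M)" for n
  proof -
    have "0 \<le> (\<integral>x. indicator (D n) x * Z n x \<partial>M)" by (rule Bochner_Integration.integral_nonneg) (simp add: Z)
    then show ?thesis using step[of n] by simp
  qed
  ultimately have "c * measure M (\<Union>n. space M - D n) \<le> (\<integral>x. Z 0 x \<partial>M)"
    by (intro LIMSEQ_le_const2) auto
  moreover have "(\<Union>n. space M - D n) = {x \<in> space M. \<exists>n. c \<le> Z n x}"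
    unfolding D_def by (auto simp: not_less) (metis le_refl leD)
  ultimately show ?thesis by simp
qed

section \<open>The exponential supermartingale and the Freedman-Bernstein tail bound\<close>

context prob_space
begin

lemma exp_supermartingale_maximal_ineq:
  assumes sd: "supermartingale_difference_seq M F \<xi>"
    and B: "0 < B" "\<And>i. i \<ge> 1 \<Longrightarrow> AE \<omega> in M. \<xi> i \<omega> \<le> B"
    and l: "0 < l" "l * B < 2" and c: "0 < c"
  defines "Z \<equiv> \<lambda>n \<omega>. exp (l * partial_sum \<xi> n \<omega> - l\<^sup>2 / (2 - l * B) * cond_variance_sum M F \<xi> n \<omega>)"
  shows "{\<omega> \<in> space M. \<exists>n. c \<le> Z n \<omega>} \<in> sets M"
    and "measure M {\<omega> \<in> space M. \<exists>n. c \<le> Z n \<omega>} \<le> 1 / c"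
proof -
  define S V where "S = partial_sum \<xi>" and "V = cond_variance_sum M F \<xi>"
  define g where "g = l\<^sup>2 / (2 - l * B)"
  define v where "v n = cond_variance M (F n) (\<xi> (Suc n))" for n
  have g: "0 \<le> g" using l by (simp add: g_def)
  have F: "filtration (space M) F" "\<And>n. subalgebra M (F n)"
    and \<xi>: "\<And>i. i \<ge> 1 \<Longrightarrow> \<xi> i \<in> borel_measurable (F i)"
      "\<And>i. i \<ge> 1 \<Longrightarrow> integrable M (\<lambda>\<omega>. (\<xi> i \<omega>)\<^sup>2)"
      "\<And>i. i \<ge> 1 \<Longrightarrow> AE \<omega> in M. real_cond_exp M (F (i - 1)) (\<xi> i) \<omega> \<le> 0"
    using sd unfolding supermartingale_difference_seq_def by auto
  interpret filtration "space M" F by (fact F)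
  have sub: "finite_measure_subalgebra M (F n)" for n
    using F(2)[of n] finite_measure_axioms
    by (simp add: finite_measure_subalgebra_def finite_measure_subalgebra_axioms_def)
  have mono: "f \<in> borel_measurable (F n)" if "f \<in> borel_measurable (F k)" "k \<le> n" for f :: "'a \<Rightarrow> real" and k n
    by (rule borel_measurable_subalgebra[OF sets_F_mono[OF that(2)] _ that(1)]) (simp only: space_F)
  have \<xi>M: "\<xi> i \<in> borel_measurable M" if "i \<ge> 1" for i
    using \<xi>(1)[OF that] measurable_from_subalg[OF F(2)] by blast
  have vm: "v n \<in> borel_measurable (F n)" for n
    unfolding v_def cond_variance_def by simp
  have S_Suc: "S (Suc n) \<omega> = S n \<omega> + \<xi> (Suc n) \<omega>" for n \<omega>
    by (simp add: S_def partial_sum_def)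
  have V_Suc: "V (Suc n) \<omega> = V n \<omega> + v n \<omega>" for n \<omega>
    by (simp add: V_def cond_variance_sum_def v_def)
  have SV0: "S 0 = (\<lambda>\<omega>. 0)" "V 0 = (\<lambda>\<omega>. 0)"
    by (auto simp: S_def V_def partial_sum_def cond_variance_sum_def)
  have Sm: "S n \<in> borel_measurable (F n)" for n
  proof (induction n)
    case (Suc n)
    then show ?case
      using mono[OF Suc, of "Suc n"] \<xi>(1)[of "Suc n"] S_Suc by (subst measurable_cong[OF S_Suc]) auto
  qed (simp add: SV0)
  \<comment> \<open>\<open>V\<close> is predictable: its value at time \<open>n\<close> is already
    known at time \<open>n - 1\<close>. At \<open>n = 0\<close> truncated subtraction gives
    \<open>F 0\<close>, harmless as \<open>V 0 = 0\<close>.\<close>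
  have Vm: "V n \<in> borel_measurable (F (n - 1))" for n
  proof (induction n)
    case (Suc n)
    then show ?case
      using mono[OF Suc, of n] vm[of n] by (subst measurable_cong[OF V_Suc]) auto
  qed (simp add: SV0)
  have Sle: "AE \<omega> in M. S n \<omega> \<le> n * B" for n
  proof (induction n)
    case (Suc n)
    then show ?case using B(2)[of "Suc n", simplified] by eventually_elim (simp add: S_Suc algebra_simps)
  qed (simp add: SV0)
  have Vge: "AE \<omega> in M. 0 \<le> V n \<omega>" for n
  proof (induction n)
    case (Suc n)
    have "AE \<omega> in M. 0 \<le> v n \<omega>"
      unfolding v_def using \<xi>M by (intro finite_measure_subalgebra.cond_variance_nonneg[OF sub]) auto
    with Suc show ?case by eventually_elim (simp add: V_Suc)
  qed (simp add: SV0)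
  have Zdef: "Z n = (\<lambda>\<omega>. exp (l * S n \<omega> - g * V n \<omega>))" for n
    by (simp add: Z_def S_def V_def g_def)
  have Zm: "Z n \<in> borel_measurable (F n)" for n
    using Sm[of n] mono[OF Vm[of n], of n] unfolding Zdef by simp
  then have ZM[measurable]: "Z n \<in> borel_measurable M" for n
    using measurable_from_subalg[OF F(2)] by blast
  \<comment> \<open>Only upper bounds on the exponent matter: \<open>S n <= n * B\<close> and
    \<open>V n >= 0\<close> almost everywhere, so \<open>Z n\<close> is essentially bounded.\<close>
  have Zi: "integrable M (Z n)" for n
    unfolding Zdef
  proof (rule integrable_exp_bounded_above)
    show "(\<lambda>\<omega>. l * S n \<omega> - g * V n \<omega>) \<in> borel_measurable M"
      using Sm[of n] mono[OF Vm[of n], of n] by (intro measurable_from_subalg[OF F(2)[of n]]) simp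
    show "AE \<omega> in M. l * S n \<omega> - g * V n \<omega> \<le> l * (n * B)"
      using Sle[of n] Vge[of n]
    proof eventually_elim
      case (elim \<omega>)
      have "l * S n \<omega> \<le> l * (n * B)" using elim l by (intro mult_left_mono) auto
      moreover have "0 \<le> g * V n \<omega>" using elim g by simp
      ultimately show ?case by linarith
    qed
  qed
  show "{\<omega> \<in> space M. \<exists>n. c \<le> Z n \<omega>} \<in> sets M" by measurable
  have "c * measure M {\<omega> \<in> space M. \<exists>n. c \<le> Z n \<omega>} \<le> (\<integral>\<omega>. Z 0 \<omega> \<partial>M)"
  proof (rule supermartingale_maximal_ineq[OF F Zm Zi])
    show "0 \<le> Z n \<omega>" for n \<omega> by (simp add: Zdef)
    fix n A assume A: "A \<in> sets (F n)"
    interpret G: finite_measure_subalgebra M "F n" by (rule sub)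
    \<comment> \<open>\<open>W\<close> is the \<open>F n\<close>-measurable factor of
      \<open>indicator A * Z (Suc n)\<close>, by predictability of \<open>V\<close>; only
      \<open>exp (l * \<xi> (Suc n))\<close> remains to be conditioned.\<close>
    define W where "W = (\<lambda>\<omega>. indicator A \<omega> * exp (l * S n \<omega> - g * V (Suc n) \<omega>))"
    define E where "E = real_cond_exp M (F n) (\<lambda>\<omega>. exp (l * \<xi> (Suc n) \<omega>))"
    have AM: "A \<in> sets M" using A F(2)[of n] unfolding subalgebra_def by blast
    have Wm: "W \<in> borel_measurable (F n)"
      unfolding W_def using A Sm[of n] Vm[of "Suc n"] by simp
    have W_eq: "W \<omega> * exp (l * \<xi> (Suc n) \<omega>) = indicator A \<omega> * Z (Suc n) \<omega>" for \<omega>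
      by (simp add: W_def Zdef S_Suc algebra_simps flip: exp_add)
    have Wi: "integrable M (\<lambda>\<omega>. W \<omega> * exp (l * \<xi> (Suc n) \<omega>))"
      unfolding W_eq using integrable_mult_indicator[OF AM Zi] by simp
    have em: "(\<lambda>\<omega>. exp (l * \<xi> (Suc n) \<omega>)) \<in> borel_measurable M" using \<xi>M[of "Suc n"] by simp
    have "(\<integral>\<omega>. indicator A \<omega> * Z (Suc n) \<omega> \<partial>M) = (\<integral>\<omega>. W \<omega> * E \<omega> \<partial>M)"
      unfolding E_def G.real_cond_exp_intg(2)[OF Wi Wm em] by (simp only: W_eq)
    also have "\<dots> \<le> (\<integral>\<omega>. indicator A \<omega> * Z n \<omega> \<partial>M)"
    proof (rule integral_mono_AE)
      show "integrable M (\<lambda>\<omega>. W \<omega> * E \<omega>)"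
        unfolding E_def by (rule G.real_cond_exp_intg(1)[OF Wi Wm em])
      show "integrable M (\<lambda>\<omega>. indicator A \<omega> * Z n \<omega>)"
        using integrable_mult_indicator[OF AM Zi] by simp
      have "AE \<omega> in M. E \<omega> \<le> exp (g * v n \<omega>)"
        unfolding E_def g_def v_def
        by (rule G.real_cond_exp_exp_le) (use \<xi>[of "Suc n"] \<xi>M[of "Suc n"] B(1) B(2)[of "Suc n"] l in auto)
      then show "AE \<omega> in M. W \<omega> * E \<omega> \<le> indicator A \<omega> * Z n \<omega>"
      proof eventually_elim
        case (elim \<omega>)
        have "W \<omega> * E \<omega> \<le> W \<omega> * exp (g * v n \<omega>)"
          using elim by (intro mult_left_mono) (auto simp: W_def)
        also have "\<dots> = indicator A \<omega> * Z n \<omega>"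
          by (simp add: W_def Zdef V_Suc algebra_simps flip: exp_add)
        finally show ?case .
      qed
    qed
    finally show "(\<integral>\<omega>. indicator A \<omega> * Z (Suc n) \<omega> \<partial>M) \<le> (\<integral>\<omega>. indicator A \<omega> * Z n \<omega> \<partial>M)" .
  qed (fact c)
  also have "\<dots> = 1" by (simp add: Zdef SV0 prob_space)
  finally show "measure M {\<omega> \<in> space M. \<exists>n. c \<le> Z n \<omega>} \<le> 1 / c"
    using c by (simp add: field_simps)
qed

text \<open>\<open>A\<close> is the event that the exponential supermartingale ever reaches
  \<open>exp e\<close>. Where the variance is at most \<open>v\<close> and the sum is large, the
  exponent is at least \<open>e\<close>, so the inclusion holds pointwise and \<open>A\<close> is
  measurable.\<close>

lemma freedman_bernstein_tail:
  assumes sd: "supermartingale_difference_seq M F \<xi>"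
    and B: "0 < B" "\<And>i. i \<ge> 1 \<Longrightarrow> AE \<omega> in M. \<xi> i \<omega> \<le> B"
    and e: "0 < e" and v: "0 < v"
  obtains A where "A \<in> sets M" "measure M A \<le> exp (- e)"
    and "\<And>n \<omega>. \<omega> \<in> space M \<Longrightarrow> cond_variance_sum M F \<xi> n \<omega> \<le> v \<Longrightarrow>
      sqrt (2 * v * e) + B / 2 * e \<le> partial_sum \<xi> n \<omega> \<Longrightarrow> \<omega> \<in> A"
proof -
  define u d where "u = sqrt (2 * e / v)" and "d = 1 + B / 2 * u"
  define l where "l = u / d"
  \<comment> \<open>The optimal \<open>l\<close> for the Bernstein-type exponent \<open>l x - l\<^sup>2 v / (2 - l B)\<close>
    at \<open>x = sqrt (2 v e) + B e / 2\<close>, where that exponent equals \<open>e\<close>.\<close>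
  define Z where "Z = (\<lambda>n \<omega>. exp (l * partial_sum \<xi> n \<omega> - l\<^sup>2 / (2 - l * B) * cond_variance_sum M F \<xi> n \<omega>))"
  have u: "0 < u" using e v by (simp add: u_def)
  have d: "0 < d" using u B by (simp add: d_def add_pos_pos)
  have lB: "2 - l * B = 2 / d" using d by (simp add: l_def d_def field_simps)
  have l: "0 < l" "l * B < 2" using u d lB by (auto simp: l_def) (smt (verit) divide_pos_pos)
  have g: "l\<^sup>2 / (2 - l * B) = u\<^sup>2 / (2 * d)"
    unfolding lB using d by (simp add: l_def power2_eq_square)
  have u2: "u\<^sup>2 * v = 2 * e" using e v by (simp add: u_def)
  have us: "u * sqrt (2 * v * e) = 2 * e"
  proof -
    have "u * sqrt (2 * v * e) = sqrt (2 * e / v * (2 * v * e))" by (simp only: u_def real_sqrt_mult)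
    also have "2 * e / v * (2 * v * e) = (2 * e)\<^sup>2" using v by (simp add: power2_eq_square)
    finally show ?thesis using e by (simp only: real_sqrt_abs abs_of_pos)
  qed
  \<comment> \<open>Over the denominator \<open>d\<close> the numerator is
    \<open>2 * e + B / 2 * u * e - e = d * e\<close>.\<close>
  have exponent: "l * (sqrt (2 * v * e) + B / 2 * e) - l\<^sup>2 / (2 - l * B) * v = e"
  proof -
    have "l * (sqrt (2 * v * e) + B / 2 * e) - l\<^sup>2 / (2 - l * B) * v
        = (u * sqrt (2 * v * e) + B / 2 * u * e - u\<^sup>2 * v / 2) / d"
      unfolding g by (simp add: l_def algebra_simps add_divide_distrib diff_divide_distrib)
    also have "\<dots> = d * e / d" unfolding us u2 by (simp add: d_def algebra_simps)
    finally show ?thesis using d by simp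
  qed
  show thesis
  proof
    show "{\<omega> \<in> space M. \<exists>n. exp e \<le> Z n \<omega>} \<in> sets M"
      unfolding Z_def by (rule exp_supermartingale_maximal_ineq(1)[OF sd B l exp_gt_zero])
    show "measure M {\<omega> \<in> space M. \<exists>n. exp e \<le> Z n \<omega>} \<le> exp (- e)"
      using exp_supermartingale_maximal_ineq(2)[OF sd B l exp_gt_zero, of e] unfolding Z_def
      by (simp add: exp_minus inverse_eq_divide)
    fix n \<omega> assume \<omega>: "\<omega> \<in> space M" and V: "cond_variance_sum M F \<xi> n \<omega> \<le> v"
      and S: "sqrt (2 * v * e) + B / 2 * e \<le> partial_sum \<xi> n \<omega>"
    have "l * (sqrt (2 * v * e) + B / 2 * e) \<le> l * partial_sum \<xi> n \<omega>"
      using S l by (intro mult_left_mono) auto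
    moreover have "l\<^sup>2 / (2 - l * B) * cond_variance_sum M F \<xi> n \<omega> \<le> l\<^sup>2 / (2 - l * B) * v"
      using V l by (intro mult_left_mono) auto
    ultimately have "exp e \<le> Z n \<omega>" unfolding Z_def using exponent by simp
    then show "\<omega> \<in> {\<omega> \<in> space M. \<exists>n. exp e \<le> Z n \<omega>}" using \<omega> by blast
  qed
qed

end

section \<open>Peeling over dyadic variance slices\<close>

text \<open>Take the floor of \<open>log 2 x\<close>. Slices may share endpoints, since a union
  bound needs only a cover; the last inequality compares the level of the slice with the random
  one.\<close>

lemma ex_dyadic_slice:
  fixes x :: real
  assumes "1 \<le> x"
  obtains j :: nat where "2 ^ j \<le> x" "x \<le> 2 ^ Suc j" "real j \<le> log 2 x"
proof -
  define j where "j = nat \<lfloor>log 2 x\<rfloor>"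
  have "0 \<le> log 2 x" using assms by simp
  then have j: "real j \<le> log 2 x" "log 2 x \<le> real (Suc j)" unfolding j_def by linarith+
  have "2 powr real j \<le> x" "x \<le> 2 powr real (Suc j)"
    using j assms by (auto simp: le_log_iff log_le_iff)
  then show thesis using that[of j] j by (simp add: powr_realpow powr_add)
qed

theorem corollary42:
  fixes M :: "'a measure" and F :: "nat \<Rightarrow> 'a measure"
    and \<xi> :: "nat \<Rightarrow> 'a \<Rightarrow> real" and B \<delta> \<kappa> :: real
    and S V V' :: "nat \<Rightarrow> 'a \<Rightarrow> real" and \<epsilon> :: "nat \<Rightarrow> 'a \<Rightarrow> real"
  assumes "prob_space M"
    and "supermartingale_difference_seq M F \<xi>"
    and "B > 0"
    and "\<And>i. i \<ge> 1 \<Longrightarrow> AE \<omega> in M. \<xi> i \<omega> \<le> B"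
  defines "S \<equiv> partial_sum \<xi>"
    and "V \<equiv> cond_variance_sum M F \<xi>"
  defines "V' \<equiv> \<lambda>k \<omega>. max (V k \<omega>) (B\<^sup>2)"
    and "\<kappa> \<equiv> pi\<^sup>2 / 6"
  defines "\<epsilon> \<equiv> \<lambda>k \<omega>. ln (1 / \<delta>) + 2 * ln (1 + log 2 (V' k \<omega> / B\<^sup>2))"
  assumes "\<delta> \<in> {0<..<1 / (1 + \<kappa>)}"
  shows "measure M {\<omega> \<in> space M. \<forall>k\<ge>1.
           S k \<omega> \<le> 2 * sqrt (V' k \<omega> * \<epsilon> k \<omega>) + 1 / 2 * B * \<epsilon> k \<omega>}
         \<ge> 1 - (1 + \<kappa>) * \<delta>"
proof -
  interpret prob_space M by fact
  define good where "good = {\<omega> \<in> space M. \<forall>k\<ge>1.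
           S k \<omega> \<le> 2 * sqrt (V' k \<omega> * \<epsilon> k \<omega>) + 1 / 2 * B * \<epsilon> k \<omega>}"
  have "0 < \<kappa>" by (simp add: \<kappa>_def)
  then have \<delta>: "0 < \<delta>" "\<delta> < 1"
    using assms(10) less_trans[of \<delta> "1 / (1 + \<kappa>)" 1] by auto
  \<comment> \<open>\<open>e j\<close> is the value of the random level at the lower end of slice
    \<open>j\<close>; the factor 2 before the logarithm makes the failure probabilities
    \<open>\<delta> / (j + 1)^2\<close> summable.\<close>
  define e where "e j = ln (1 / \<delta>) + 2 * ln (1 + real j)" for j
  have e: "0 < e j" for j
  proof -
    have "0 < ln (1 / \<delta>)" using \<delta> by simp
    then show ?thesis unfolding e_def by (simp add: add_pos_nonneg)
  qed
  have exp_e: "exp (- e j) = \<delta> * (1 / (real j + 1)\<^sup>2)" for j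
  proof -
    have "- e j = ln \<delta> + - ln ((real j + 1)\<^sup>2)"
      using \<delta> by (simp add: e_def ln_div ln_realpow add.commute)
    then have "exp (- e j) = exp (ln \<delta>) * exp (- ln ((real j + 1)\<^sup>2))"
      by (simp only: exp_add)
    then show ?thesis using \<delta> by (simp add: exp_minus inverse_eq_divide)
  qed
  have "\<exists>A. A \<in> sets M \<and> measure M A \<le> exp (- e j) \<and>
      (\<forall>n. \<forall>\<omega>\<in>space M. V n \<omega> \<le> 2 ^ Suc j * B\<^sup>2 \<longrightarrow>
        sqrt (2 * (2 ^ Suc j * B\<^sup>2) * e j) + B / 2 * e j \<le> S n \<omega> \<longrightarrow> \<omega> \<in> A)" for j
    by (rule freedman_bernstein_tail[OF assms(2-4) e[of j], of "2 ^ Suc j * B\<^sup>2"])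
      (use \<open>B > 0\<close> in \<open>auto simp: V_def S_def\<close>)
  then obtain A where A: "\<And>j. A j \<in> sets M" "\<And>j. measure M (A j) \<le> exp (- e j)"
    "\<And>j n \<omega>. \<omega> \<in> space M \<Longrightarrow> V n \<omega> \<le> 2 ^ Suc j * B\<^sup>2 \<Longrightarrow>
        sqrt (2 * (2 ^ Suc j * B\<^sup>2) * e j) + B / 2 * e j \<le> S n \<omega> \<Longrightarrow> \<omega> \<in> A j"
    by metis
  have sums: "(\<lambda>j. exp (- e j)) sums (\<delta> * \<kappa>)"
    unfolding exp_e \<kappa>_def using inverse_squares_sums by (intro sums_mult) (simp add: add.commute)
  have summable: "summable (\<lambda>j. measure M (A j))"
    by (rule summable_comparison_test[OF _ sums_summable[OF sums]]) (use A(2) in auto)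
  have "measure M (\<Union>j. A j) \<le> (\<Sum>j. measure M (A j))"
    using A(1) summable by (intro finite_measure_subadditive_countably) auto
  also have "\<dots> \<le> (\<Sum>j. exp (- e j))"
    using A(2) summable sums_summable[OF sums] by (intro suminf_le) auto
  also have "\<dots> = \<delta> * \<kappa>" using sums by (simp add: sums_iff)
  finally have UA: "measure M (\<Union>j. A j) \<le> \<delta> * \<kappa>" .
  \<comment> \<open>This inclusion is pointwise: the almost-everywhere hypotheses enter only through
    the measures of the sets \<open>A j\<close>.\<close>
  have compl_good: "space M - (\<Union>j. A j) \<subseteq> good"
  proof
    fix \<omega> assume "\<omega> \<in> space M - (\<Union>j. A j)"
    then have \<omega>: "\<omega> \<in> space M" "\<And>j. \<omega> \<notin> A j" by auto
    have "S k \<omega> \<le> 2 * sqrt (V' k \<omega> * \<epsilon> k \<omega>) + 1 / 2 * B * \<epsilon> k \<omega>" for k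
    proof -
      have "1 \<le> V' k \<omega> / B\<^sup>2" using \<open>B > 0\<close> by (simp add: V'_def)
      then obtain j :: nat where j: "2 ^ j \<le> V' k \<omega> / B\<^sup>2" "V' k \<omega> / B\<^sup>2 \<le> 2 ^ Suc j"
        "real j \<le> log 2 (V' k \<omega> / B\<^sup>2)"
        by (rule ex_dyadic_slice)
      have V': "2 ^ j * B\<^sup>2 \<le> V' k \<omega>" "V' k \<omega> \<le> 2 ^ Suc j * B\<^sup>2"
        using j(1,2) \<open>B > 0\<close> by (simp_all add: field_simps)
      have ee: "e j \<le> \<epsilon> k \<omega>" unfolding e_def \<epsilon>_def using j(3) by simp
      have "V k \<omega> \<le> 2 ^ Suc j * B\<^sup>2" using V'(2) by (simp add: V'_def)
      then have "S k \<omega> < sqrt (2 * (2 ^ Suc j * B\<^sup>2) * e j) + B / 2 * e j"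
        using A(3)[OF \<omega>(1), of k j] \<omega>(2)[of j] by force
      \<comment> \<open>The upper end of the slice is twice the lower one, which turns the constant
        \<open>sqrt 2\<close> of the tail bound into the 2 of the theorem.\<close>
      also have "2 * (2 ^ Suc j * B\<^sup>2) * e j = 2\<^sup>2 * (2 ^ j * B\<^sup>2 * e j)" by simp
      also have "sqrt \<dots> = 2 * sqrt (2 ^ j * B\<^sup>2 * e j)" by (simp only: real_sqrt_mult real_sqrt_abs abs_numeral)
      also have "\<dots> + B / 2 * e j \<le> 2 * sqrt (V' k \<omega> * \<epsilon> k \<omega>) + 1 / 2 * B * \<epsilon> k \<omega>"
      proof -
        have "sqrt (2 ^ j * B\<^sup>2 * e j) \<le> sqrt (V' k \<omega> * \<epsilon> k \<omega>)"
          using V'(1) ee e[of j]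
          by (intro real_sqrt_le_mono mult_mono) (auto simp: V'_def max.coboundedI2)
        moreover have "B * e j \<le> B * \<epsilon> k \<omega>" using ee \<open>B > 0\<close> by simp
        ultimately show ?thesis by (simp del: real_sqrt_le_iff)
      qed
      finally show ?thesis by simp
    qed
    then show "\<omega> \<in> good" using \<omega>(1) by (simp add: good_def)
  qed
  \<comment> \<open>\<open>measure\<close> is 0 by default on nonmeasurable sets, so the inclusion
    yields a lower bound only once \<open>good\<close> is known to be measurable.\<close>
  have good_meas: "good \<in> sets M"
  proof -
    have "subalgebra M (F i)" for i
      using assms(2) by (simp add: supermartingale_difference_seq_def)
    moreover have "\<xi> i \<in> borel_measurable (F i)" if "i \<ge> 1" for i
      using assms(2) that by (simp add: supermartingale_difference_seq_def)
    ultimately have "\<xi> i \<in> borel_measurable M" if "i \<in> {1..k}" for i k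
      using that measurable_from_subalg by (metis atLeastAtMost_iff)
    then have [measurable]: "S k \<in> borel_measurable M" for k
      unfolding S_def partial_sum_def[abs_def] by (intro borel_measurable_sum) auto
    have [measurable]: "V k \<in> borel_measurable M" for k
      unfolding V_def cond_variance_sum_def[abs_def] cond_variance_def by measurable
    have [measurable]: "V' k \<in> borel_measurable M" for k
      unfolding V'_def by measurable
    have [measurable]: "\<epsilon> k \<in> borel_measurable M" for k
      unfolding \<epsilon>_def log_def by measurable
    show ?thesis unfolding good_def by measurable
  qed
  have "1 - (1 + \<kappa>) * \<delta> \<le> 1 - measure M (\<Union>j. A j)"
    using UA \<delta> by (simp add: algebra_simps)
  also have "\<dots> = measure M (space M - (\<Union>j. A j))"
    using A(1) by (subst prob_compl) auto
  also have "\<dots> \<le> measure M good"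
    using compl_good good_meas by (rule finite_measure_mono)
  finally show ?thesis by (simp add: good_def)
qed

end
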